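(* Let $\mathcal X=\{1,\dots,n\}$, let $N\ge 1$, let $M(t)=[m_{ij}(t)]_{i,j\in\mathcal X}$, $t=0,\dots,N-1$, be matrices with nonnegative entries (rows not necessarily summing to one) with $m_{ij}(t)=0$ whenever $ij\notin\mathcal E$, where $\mathbf G=(\mathcal X,\mathcal E)$ is a directed, strongly connected, aperiodic graph, and let $\nu_0,\nu_N$ be probability distributions on $\mathcal X$. Suppose there exists a pair of nonnegative functions $(\varphi,\hat\varphi)$ defined on $\{0,1,\dots,N\}\times\mathcal X$ satisfying $$\varphi(t,x_t)=\sum_{x_{t+1}\in\mathcal X}m_{x_tx_{t+1}}(t)\,\varphi(t+1,x_{t+1}),$$ $$\hat\varphi(t+1,x_{t+1})=\sum_{x_t\in\mathcal X}m_{x_tx_{t+1}}(t)\,\hat\varphi(t,x_t),$$ for $0\le t\le N-1$ and all $x_t,x_{t+1}\in\mathcal X$, as well as the boundary conditions $$\varphi(0,x_0)\,\hat\varphi(0,x_0)=\nu_0(x_0),\qquad \varphi(N,x_N)\,\hat\varphi(N,x_N)=\nu_N(x_N)$$ for all $x_0,x_N\in\mathcal X$. Suppose moreover that $\varphi(t,i)>0$ for all $0\le t\le N$ and all $i\in\mathcal X$. Then the Markov distribution $\mathfrak P^*\in\mathcal P(\nu_0,\nu_N)$ (with initial marginal $\nu_0$) having transition probabilities $$\pi^*_{x_tx_{t+1}}(t)=m_{x_tx_{t+1}}(t)\,\frac{\varphi(t+1,x_{t+1})}{\varphi(t,x_t)}$$ solves the fluid-dynamic Schrödinger bridge problem; that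 is, the pair $(p^*,\pi^* )$, where $p^*_t$ are the one-time marginals of $\mathfrak P^*$, minimizes $$\sum_{t=0}^{N-1}\sum_{x_t\in\mathcal X}\mathfrak D\big(\pi_{x_t\,\cdot}(t)\,\|\,m_{x_t\,\cdot}(t)\big)\,p_t(x_t)$$ over all pairs $(p,\pi)$ subject to $$p_{t+1}(x_{t+1})=\sum_{x_t\in\mathcal X}p_t(x_t)\,\pi_{x_tx_{t+1}}(t),\qquad \sum_{x_{t+1}\in\mathcal X}\pi_{x_tx_{t+1}}(t)=1\ \ \forall x_t\in\mathcal X,\quad t=0,\dots,N-1,$$ $$p_0=\nu_0,\qquad p_N=\nu_N.$$
   Context: A feasible path of length $N$ on $\mathbf G$ is $x=(x_0,\dots,x_N)\in\mathcal X^{N+1}$ with $x_ix_{i+1}\in\mathcal E$ for $i=0,\dots,N-1$. $\mathcal P(\nu_0,\nu_N)$ denotes the set of probability distributions on the set of feasible paths whose marginals at times $0$ and $N$ are $\nu_0$ and $\nu_N$. A Markov distribution with initial marginal $\nu_0$ and transition probabilities $\pi_{ij}(t)$ assigns to a path the probability $\nu_0(x_0)\pi_{x_0x_1}(0)\cdots\pi_{x_{N-1}x_N}(N-1)$. In the minimization, $p=\{p_t\}_{t=0}^N$ is a flow of probability distributions on $\mathcal X$ and $\pi=\{\pi_{ij}(t)\}_{t=0}^{N-1}$ is a flow of (nonnegative) transition probabilities. Relative entropy: for a probability vector $a$ and a nonnegative vector $b$ on $\mathcal X$, $\mathfrak D(a\|b)=\sum_x a(x)\log\frac{a(x)}{b(x)}$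 if $\mathrm{Supp}(a)\subseteq\mathrm{Supp}(b)$ and $+\infty$ otherwise, with $0\log 0=0$ (it may be negative since $b$ need not have total mass one). In a product with weight $p_t(x_t)=0$ the convention $0\cdot(+\infty)=0$ is used. Here $\pi_{x_t\,\cdot}(t)$ and $m_{x_t\,\cdot}(t)$ denote the $x_t$-th rows. *)

theory Defs
  imports "HOL-Probability.Probability" "Graph_Theory.Graph_Theory"
begin

text \<open>
  A loop counts as a cycle of length 1. An acyclic graph has \<open>Gcd {} = 0\<close>, so it is not aperiodic.
\<close>

definition aperiodic :: "('a, 'b) pre_digraph \<Rightarrow> bool" where
  "aperiodic G \<longleftrightarrow> Gcd {length c | c. pre_digraph.cycle G c} = 1"

definition feasible_paths :: "'a pair_pre_digraph \<Rightarrow> nat \<Rightarrow> 'a list set" where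
  "feasible_paths G N =
     {x. length x = N + 1 \<and> set x \<subseteq> pverts G \<and> (\<forall>i<N. (x ! i, x ! (i + 1)) \<in> parcs G)}"

definition path_marginal :: "'a list pmf \<Rightarrow> nat \<Rightarrow> 'a pmf" where
  "path_marginal P t = map_pmf (\<lambda>x. x ! t) P"

definition path_distributions ::
  "'a pair_pre_digraph \<Rightarrow> nat \<Rightarrow> 'a pmf \<Rightarrow> 'a pmf \<Rightarrow> 'a list pmf set" where
  "path_distributions G N \<nu>0 \<nu>N =
     {P. set_pmf P \<subseteq> feasible_paths G N \<and> path_marginal P 0 = \<nu>0 \<and> path_marginal P N = \<nu>N}"

text \<open>
  A transition matrix is a function \<open>\<pi>\<close> where \<open>\<pi> t i j\<close> is the probability of moving from
  \<open>i\<close> to \<open>j\<close> between times \<open>t\<close> and \<open>t + 1\<close>; only \<open>t < N\<close> and \<open>i, j \<in> X\<close> are relevant.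
  The product formula is required on all of \<open>X\<^sup>N\<^sup>+\<^sup>1\<close>, so it determines \<open>P\<close> uniquely.
\<close>

definition markov_distribution ::
  "'a set \<Rightarrow> nat \<Rightarrow> 'a pmf \<Rightarrow> (nat \<Rightarrow> 'a \<Rightarrow> 'a \<Rightarrow> real) \<Rightarrow> 'a list pmf \<Rightarrow> bool" where
  "markov_distribution X N \<nu>0 \<pi> P \<longleftrightarrow>
     set_pmf P \<subseteq> {x. length x = N + 1 \<and> set x \<subseteq> X} \<and>
     (\<forall>x. length x = N + 1 \<and> set x \<subseteq> X \<longrightarrow>
        pmf P x = pmf \<nu>0 (x ! 0) * (\<Prod>t<N. \<pi> t (x ! t) (x ! (t + 1))))"

text \<open>
  The second argument need not have total mass one, so the value may be negative.
  Terms with \<open>a x = 0\<close> vanish, which is the convention \<open>0 log 0 = 0\<close>.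
\<close>

definition rel_entropy :: "'a set \<Rightarrow> ('a \<Rightarrow> real) \<Rightarrow> ('a \<Rightarrow> real) \<Rightarrow> ereal" where
  "rel_entropy X a b =
     (if {x \<in> X. a x \<noteq> 0} \<subseteq> {x \<in> X. b x \<noteq> 0}
      then ereal (\<Sum>x\<in>X. a x * ln (a x / b x)) else \<infinity>)"

text \<open>
  In \<^typ>\<open>ereal\<close> one has \<open>\<infinity> * 0 = 0\<close>, so rows of zero weight do not contribute. No
  summand is \<open>-\<infinity>\<close>.
\<close>

definition bridge_cost ::
  "'a set \<Rightarrow> nat \<Rightarrow> (nat \<Rightarrow> 'a \<Rightarrow> 'a \<Rightarrow> real) \<Rightarrow> (nat \<Rightarrow> 'a pmf) \<Rightarrow>
   (nat \<Rightarrow> 'a \<Rightarrow> 'a \<Rightarrow> real) \<Rightarrow> ereal" where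
  "bridge_cost X N m p \<pi> =
     (\<Sum>t<N. \<Sum>x\<in>X. rel_entropy X (\<pi> t x) (m t x) * ereal (pmf (p t) x))"

definition bridge_feasible ::
  "'a set \<Rightarrow> nat \<Rightarrow> 'a pmf \<Rightarrow> 'a pmf \<Rightarrow> (nat \<Rightarrow> 'a pmf) \<Rightarrow>
   (nat \<Rightarrow> 'a \<Rightarrow> 'a \<Rightarrow> real) \<Rightarrow> bool" where
  "bridge_feasible X N \<nu>0 \<nu>N p \<pi> \<longleftrightarrow>
     (\<forall>t\<le>N. set_pmf (p t) \<subseteq> X) \<and>
     (\<forall>t<N. \<forall>x\<in>X. \<forall>y\<in>X. 0 \<le> \<pi> t x y) \<and>
     (\<forall>t<N. \<forall>y\<in>X. pmf (p (t + 1)) y = (\<Sum>x\<in>X. pmf (p t) x * \<pi> t x y)) \<and>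
     (\<forall>t<N. \<forall>x\<in>X. (\<Sum>y\<in>X. \<pi> t x y) = 1) \<and>
     p 0 = \<nu>0 \<and> p N = \<nu>N"

definition solves_bridge_problem ::
  "'a set \<Rightarrow> nat \<Rightarrow> (nat \<Rightarrow> 'a \<Rightarrow> 'a \<Rightarrow> real) \<Rightarrow> 'a pmf \<Rightarrow> 'a pmf \<Rightarrow> (nat \<Rightarrow> 'a pmf) \<Rightarrow>
   (nat \<Rightarrow> 'a \<Rightarrow> 'a \<Rightarrow> real) \<Rightarrow> bool" where
  "solves_bridge_problem X N m \<nu>0 \<nu>N p \<pi> \<longleftrightarrow>
     is_arg_min (\<lambda>(p, \<pi>). bridge_cost X N m p \<pi>)
       (\<lambda>(p, \<pi>). bridge_feasible X N \<nu>0 \<nu>N p \<pi>) (p, \<pi>)"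

end

theory Submission
  imports Defs
begin

text \<open>
  By the Gibbs variational principle, the divergence of a transition row from row \<open>i\<close> of \<open>m t\<close>
  is at least the expectation of \<open>ln (\<phi> (t + 1))\<close> under that row minus \<open>ln (\<phi> t i)\<close>, with
  equality for the row of \<open>\<pi>s\<close>. Averaged against a feasible flow these lower bounds telescope to
  \<open>\<integral> ln (\<phi> N) d\<nu>N - \<integral> ln (\<phi> 0) d\<nu>0\<close>, which depends on the boundary marginals only. The flow of
  \<open>\<pi>s\<close> started at \<open>\<nu>0\<close> has the marginals \<open>\<phi> t * \<phi>h t\<close>, so it is feasible and attains the bound.
\<close>

section \<open>Construction of the Markov path distribution and its marginals\<close>

lemma pmf_of_finite_weights:
  fixes a :: "'a \<Rightarrow> real"
  assumes "finite X" and "\<And>x. x \<in> X \<Longrightarrow> 0 \<le> a x" and "sum a X = 1"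
  shows "\<exists>K. \<forall>x. pmf K x = (if x \<in> X then a x else 0)"
proof (intro exI allI)
  fix x
  let ?f = "\<lambda>x. if x \<in> X then a x else 0"
  have "(\<integral>\<^sup>+ x. ennreal (?f x) \<partial>count_space UNIV) = (\<integral>\<^sup>+ x. ennreal (a x) \<partial>count_space X)"
    by (subst nn_integral_count_space_indicator)
       (auto intro!: nn_integral_cong simp: indicator_def)
  also have "\<dots> = ennreal (sum a X)"
    using assms by (simp add: nn_integral_count_space_finite sum_ennreal)
  finally show "pmf (embed_pmf ?f) x = ?f x"
    using assms by (intro pmf_embed_pmf) auto
qed

lemma pmf_eqI_on:
  assumes "set_pmf p \<subseteq> X" and "set_pmf q \<subseteq> X" and "\<And>x. x \<in> X \<Longrightarrow> pmf p x = pmf q x"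
  shows "p = q"
proof (rule pmf_eqI)
  fix x
  show "pmf p x = pmf q x"
    using assms by (metis pmf_eq_0_set_pmf subsetD)
qed

text \<open>Induction on the horizon: a path of length \<open>N\<close> is extended by one vertex
  drawn from the row of its last vertex. This adds one factor to the product formula and leaves all
  earlier marginals alone, so only the forward equation for the last time is new.\<close>

lemma markov_distribution_exists:
  fixes \<nu>0 :: "'a pmf" and \<pi> :: "nat \<Rightarrow> 'a \<Rightarrow> 'a \<Rightarrow> real"
  assumes "finite X" and "set_pmf \<nu>0 \<subseteq> X"
    and "\<And>t x y. t < N \<Longrightarrow> x \<in> X \<Longrightarrow> y \<in> X \<Longrightarrow> 0 \<le> \<pi> t x y"
    and "\<And>t x. t < N \<Longrightarrow> x \<in> X \<Longrightarrow> (\<Sum>y\<in>X. \<pi> t x y) = 1"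
  shows "\<exists>P. markov_distribution X N \<nu>0 \<pi> P \<and> path_marginal P 0 = \<nu>0 \<and>
    (\<forall>t<N. \<forall>y\<in>X. pmf (path_marginal P (t + 1)) y =
       (\<Sum>x\<in>X. pmf (path_marginal P t) x * \<pi> t x y))"
  using assms(3,4)
proof (induction N)
  case 0
  have eq: "pmf (map_pmf (\<lambda>a. [a]) \<nu>0) x = pmf \<nu>0 (x ! 0)" if len: "length x = 1" for x
  proof -
    obtain a where "x = [a]" using len by (cases x) auto
    then show ?thesis using pmf_map_inj'[of "\<lambda>a. [a]" \<nu>0 a] by (simp add: inj_def)
  qed
  show ?case
    by (rule exI[of _ "map_pmf (\<lambda>a. [a]) \<nu>0"])
       (use assms(2) eq in \<open>auto simp: markov_distribution_def path_marginal_def pmf.map_comp o_def\<close>)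
next
  case (Suc N)
  then obtain P where P: "markov_distribution X N \<nu>0 \<pi> P" and P0: "path_marginal P 0 = \<nu>0"
    and step: "\<And>t y. t < N \<Longrightarrow> y \<in> X \<Longrightarrow> pmf (path_marginal P (t + 1)) y =
       (\<Sum>x\<in>X. pmf (path_marginal P t) x * \<pi> t x y)"
    by auto
  have supp: "length xs = N + 1" "set xs \<subseteq> X" if "xs \<in> set_pmf P" for xs
    using P that by (auto simp: markov_distribution_def)
  \<comment> \<open>Nothing is known about \<open>\<pi> N x y\<close> for \<open>y\<close> outside
    \<open>X\<close>, so each row is cut off there before it is read as a distribution.\<close>
  have "\<exists>K. \<forall>y. pmf K y = (if y \<in> X then \<pi> N x y else 0)" if "x \<in> X" for x
    using assms(1) Suc.prems that by (intro pmf_of_finite_weights) auto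
  then obtain K where K: "\<And>x y. x \<in> X \<Longrightarrow> pmf (K x) y = (if y \<in> X then \<pi> N x y else 0)"
    by metis
  have KX: "set_pmf (K x) \<subseteq> X" if "x \<in> X" for x
    using K[OF that] by (auto simp: set_pmf_iff split: if_splits)
  define Q where "Q = bind_pmf P (\<lambda>xs. map_pmf (\<lambda>y. xs @ [y]) (K (xs ! N)))"
  have Qsupp: "set_pmf Q \<subseteq> {x. length x = Suc N + 1 \<and> set x \<subseteq> X}"
  proof
    fix z assume "z \<in> set_pmf Q"
    then obtain xs y where z: "xs \<in> set_pmf P" "y \<in> set_pmf (K (xs ! N))" "z = xs @ [y]"
      by (auto simp: Q_def)
    have "xs ! N \<in> X" using supp[OF z(1)] by auto
    then show "z \<in> {x. length x = Suc N + 1 \<and> set x \<subseteq> X}"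
      using z supp[OF z(1)] KX by auto
  qed
  have Qpmf: "pmf Q z = pmf \<nu>0 (z ! 0) * (\<Prod>t<Suc N. \<pi> t (z ! t) (z ! (t + 1)))"
    if z: "length z = Suc N + 1" "set z \<subseteq> X" for z
  proof -
    obtain xs y where zz: "z = xs @ [y]" and len: "length xs = N + 1"
      using z(1) by (cases z rule: rev_cases) auto
    have xsX: "set xs \<subseteq> X" and yX: "y \<in> X" using z zz by auto
    have lastX: "xs ! N \<in> X" using xsX len by auto
    \<comment> \<open>The prefix can be recovered from an extended path, so only
      \<open>us = xs\<close> can produce \<open>xs @ [y]\<close>. The expectation over
      \<open>P\<close> below therefore collapses to the single atom \<open>xs\<close>.\<close>
    have app: "pmf (map_pmf (\<lambda>b. us @ [b]) (K (us ! N))) (xs @ [y])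
        = (if us = xs then pmf (K (xs ! N)) y else 0)" for us
    proof (cases "us = xs")
      case True
      then show ?thesis
        using pmf_map_inj'[of "\<lambda>b. xs @ [b]" "K (xs ! N)" y] by (simp add: inj_def)
    next
      case False
      then have "xs @ [y] \<notin> set_pmf (map_pmf (\<lambda>b. us @ [b]) (K (us ! N)))" by auto
      then show ?thesis using False by (metis pmf_eq_0_set_pmf)
    qed
    have "pmf Q z = measure_pmf.expectation P (\<lambda>us. pmf (K (xs ! N)) y * indicator {xs} us)"
      unfolding Q_def pmf_bind zz by (intro Bochner_Integration.integral_cong) (auto simp: app)
    also have "\<dots> = pmf P xs * \<pi> N (xs ! N) y"
      using K[OF lastX, of y] yX by (simp add: measure_pmf_single)
    also have "pmf P xs = pmf \<nu>0 (xs ! 0) * (\<Prod>t<N. \<pi> t (xs ! t) (xs ! (t + 1)))"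
      using P len xsX by (auto simp: markov_distribution_def)
    also have "(\<Prod>t<N. \<pi> t (xs ! t) (xs ! (t + 1))) = (\<Prod>t<N. \<pi> t (z ! t) (z ! (t + 1)))"
      using len by (intro prod.cong) (auto simp: zz nth_append)
    finally show ?thesis using len by (simp add: zz nth_append)
  qed
  \<comment> \<open>Position \<open>t\<close> lies inside the prefix, so the appended vertex is
    drawn and then ignored.\<close>
  have Qold: "path_marginal Q t = path_marginal P t" if "t \<le> N" for t
  proof -
    have "path_marginal Q t = bind_pmf P (\<lambda>xs. map_pmf (\<lambda>y. (xs @ [y]) ! t) (K (xs ! N)))"
      by (simp add: path_marginal_def Q_def map_bind_pmf pmf.map_comp o_def)
    also have "\<dots> = bind_pmf P (\<lambda>xs. return_pmf (xs ! t))"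
    proof (rule bind_pmf_cong[OF refl])
      fix xs assume "xs \<in> set_pmf P"
      then have "(\<lambda>y. (xs @ [y]) ! t) = (\<lambda>_. xs ! t)"
        using supp that by (auto simp: nth_append)
      then show "map_pmf (\<lambda>y. (xs @ [y]) ! t) (K (xs ! N)) = return_pmf (xs ! t)"
        by simp
    qed
    also have "\<dots> = path_marginal P t" by (simp add: path_marginal_def map_pmf_def)
    finally show ?thesis .
  qed
  have Qnew: "path_marginal Q (N + 1) = bind_pmf (path_marginal P N) K"
  proof -
    have "path_marginal Q (N + 1) = bind_pmf P (\<lambda>xs. map_pmf (\<lambda>y. (xs @ [y]) ! (N + 1)) (K (xs ! N)))"
      by (simp add: path_marginal_def Q_def map_bind_pmf pmf.map_comp o_def)
    also have "\<dots> = bind_pmf P (\<lambda>xs. K (xs ! N))"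
    proof (rule bind_pmf_cong[OF refl])
      fix xs assume "xs \<in> set_pmf P"
      then have "(\<lambda>y. (xs @ [y]) ! (N + 1)) = (\<lambda>y. y)"
        using supp by (auto simp: nth_append)
      then show "map_pmf (\<lambda>y. (xs @ [y]) ! (N + 1)) (K (xs ! N)) = K (xs ! N)"
        by simp
    qed
    finally show ?thesis by (simp add: path_marginal_def bind_map_pmf)
  qed
  \<comment> \<open>Lets the expectation that comes from \<open>bind_pmf\<close> be written as a
    finite sum over \<open>X\<close>.\<close>
  have margX: "set_pmf (path_marginal P N) \<subseteq> X"
    using supp by (fastforce simp: path_marginal_def)
  have stepN: "pmf (path_marginal Q (N + 1)) y = (\<Sum>x\<in>X. pmf (path_marginal P N) x * \<pi> N x y)"
    if "y \<in> X" for y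
  proof -
    have "pmf (path_marginal Q (N + 1)) y = (\<Sum>x\<in>X. pmf (K x) y * pmf (path_marginal P N) x)"
      unfolding Qnew pmf_bind by (intro integral_measure_pmf_real) (use assms(1) margX in auto)
    also have "\<dots> = (\<Sum>x\<in>X. pmf (path_marginal P N) x * \<pi> N x y)"
      using K that by (intro sum.cong) auto
    finally show ?thesis .
  qed
  show ?case
  proof (intro exI[of _ Q] conjI allI impI ballI)
    show "markov_distribution X (Suc N) \<nu>0 \<pi> Q"
      unfolding markov_distribution_def using Qsupp Qpmf by blast
    show "path_marginal Q 0 = \<nu>0" using Qold[of 0] P0 by simp
    fix t y assume t: "t < Suc N" and y: "y \<in> X"
    show "pmf (path_marginal Q (t + 1)) y = (\<Sum>x\<in>X. pmf (path_marginal Q t) x * \<pi> t x y)"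
    proof (cases "t = N")
      case True
      then show ?thesis using stepN[OF y] Qold[of N] by simp
    next
      case False
      then show ?thesis using t step[OF _ y, of t] Qold[of t] Qold[of "t + 1"] by simp
    qed
  qed
qed

text \<open>A path that uses a missing arc has a zero factor in its product formula, hence
  probability zero.\<close>

lemma markov_distribution_feasible_paths:
  assumes "markov_distribution X N \<nu>0 \<pi> P" and "pverts G = X"
    and "\<And>t x y. t < N \<Longrightarrow> x \<in> X \<Longrightarrow> y \<in> X \<Longrightarrow> (x, y) \<notin> parcs G \<Longrightarrow> \<pi> t x y = 0"
  shows "set_pmf P \<subseteq> feasible_paths G N"
proof
  fix x assume x: "x \<in> set_pmf P"
  then have len: "length x = N + 1" and xX: "set x \<subseteq> X"
    and nz: "(\<Prod>t<N. \<pi> t (x ! t) (x ! (t + 1))) \<noteq> 0"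
    using assms(1) by (auto simp: markov_distribution_def set_pmf_iff)
  have "(x ! t, x ! (t + 1)) \<in> parcs G" if "t < N" for t
  proof (rule ccontr)
    assume "(x ! t, x ! (t + 1)) \<notin> parcs G"
    moreover have "x ! t \<in> X" "x ! (t + 1) \<in> X" using len xX that by auto
    ultimately show False using nz assms(3)[OF that] that by auto
  qed
  then show "x \<in> feasible_paths G N"
    using len xX assms(2) by (simp add: feasible_paths_def)
qed

section \<open>The Gibbs variational principle for unnormalized reference weights\<close>

text \<open>The constant \<open>c\<close> normalizes the tilted weights \<open>b x * h x / c\<close>
  to total mass one. The bound is nonnegativity of the divergence of \<open>a\<close> from them,
  obtained from \<open>ln r <= r - 1\<close>. If the support condition fails, the right-hand side is
  infinite.\<close>

lemma gibbs_variational_ge: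
  fixes a b h :: "'a \<Rightarrow> real"
  assumes "finite X" and "\<And>x. x \<in> X \<Longrightarrow> 0 \<le> a x" and "\<And>x. x \<in> X \<Longrightarrow> 0 \<le> b x"
    and "sum a X = 1" and "\<And>x. x \<in> X \<Longrightarrow> 0 < h x"
    and "(\<Sum>x\<in>X. b x * h x) = c" and "0 < c"
  shows "ereal ((\<Sum>x\<in>X. a x * ln (h x)) - ln c) \<le> rel_entropy X a b"
proof (cases "{x \<in> X. a x \<noteq> 0} \<subseteq> {x \<in> X. b x \<noteq> 0}")
  case True
  \<comment> \<open>The correction \<open>a x - b x * h x / c\<close> makes the inequality hold
    pointwise and sums to \<open>1 - 1 = 0\<close>.\<close>
  have *: "a x * ln (h x) - a x * ln c + (a x - b x * h x / c) \<le> a x * ln (a x / b x)"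
    if x: "x \<in> X" for x
  proof (cases "a x = 0")
    case True
    then show ?thesis using assms(3,5,7) x by (simp add: less_imp_le)
  next
    case False
    then have pos: "0 < a x" "0 < b x" "0 < h x"
      using assms(2,3,5)[OF x] x \<open>_ \<subseteq> _\<close> by force+
    let ?r = "b x * h x / (c * a x)"
    have "a x * ln ?r \<le> a x * (?r - 1)"
      using pos assms(7) by (intro mult_left_mono ln_le_minus_one) auto
    also have "\<dots> = b x * h x / c - a x" using pos assms(7) by (simp add: field_simps)
    finally show ?thesis
      using pos assms(7) by (simp add: ln_div ln_mult algebra_simps)
  qed
  have "(\<Sum>x\<in>X. a x * ln (h x)) - ln c
      = (\<Sum>x\<in>X. a x * ln (h x) - a x * ln c + (a x - b x * h x / c))"
    using assms(4,6,7)
    by (simp add: sum.distrib sum_subtractf flip: sum_distrib_right sum_divide_distrib)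
  also have "\<dots> \<le> (\<Sum>x\<in>X. a x * ln (a x / b x))" by (intro sum_mono *)
  finally show ?thesis using True by (simp add: rel_entropy_def)
qed (simp add: rel_entropy_def)

text \<open>At the tilted weights the log ratio is exactly \<open>ln (h x) - ln c\<close> wherever
  \<open>b x\<close> is nonzero, and the remaining terms vanish. The grouping
  \<open>b x * (h x / c)\<close> matches the rows of \<open>\<pi>s\<close> literally.\<close>

lemma gibbs_variational_eq:
  fixes b h :: "'a \<Rightarrow> real"
  assumes "\<And>x. x \<in> X \<Longrightarrow> 0 < h x" and "(\<Sum>x\<in>X. b x * h x) = c" and "0 < c"
  shows "rel_entropy X (\<lambda>x. b x * (h x / c)) b
    = ereal ((\<Sum>x\<in>X. b x * (h x / c) * ln (h x)) - ln c)"
proof -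
  have "(\<Sum>x\<in>X. b x * (h x / c) * ln (b x * (h x / c) / b x))
      = (\<Sum>x\<in>X. b x * (h x / c) * ln (h x) - b x * h x / c * ln c)"
  proof (rule sum.cong[OF refl])
    fix x assume "x \<in> X"
    then have "0 < h x" by (rule assms)
    then show "b x * (h x / c) * ln (b x * (h x / c) / b x)
        = b x * (h x / c) * ln (h x) - b x * h x / c * ln c"
      using assms(3) by (cases "b x = 0") (simp_all add: ln_div algebra_simps diff_divide_distrib)
  qed
  also have "\<dots> = (\<Sum>x\<in>X. b x * (h x / c) * ln (h x)) - ln c"
    using assms(2,3)
    by (simp add: sum_subtractf flip: sum_distrib_right sum_divide_distrib)
  finally show ?thesis by (auto simp: rel_entropy_def)
qed

section \<open>Telescoping of a potential along a feasible flow\<close>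

text \<open>By the forward equation, the mean under \<open>p t\<close> of the expected next
  potential is the mean of \<open>g (t + 1)\<close> under \<open>p (t + 1)\<close>. The double sum
  in \<open>ereal\<close> has the shape of \<open>bridge_cost\<close>, so that the two can be
  compared summand by summand.\<close>

lemma bridge_potential_telescope:
  fixes g :: "nat \<Rightarrow> 'a \<Rightarrow> real"
  assumes "bridge_feasible X N \<nu>0 \<nu>N p \<pi>"
  shows "(\<Sum>t<N. \<Sum>x\<in>X. ereal ((\<Sum>y\<in>X. \<pi> t x y * g (t + 1) y) - g t x) * ereal (pmf (p t) x))
    = ereal ((\<Sum>x\<in>X. pmf \<nu>N x * g N x) - (\<Sum>x\<in>X. pmf \<nu>0 x * g 0 x))"
proof -
  define S where "S t = (\<Sum>x\<in>X. pmf (p t) x * g t x)" for t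
  have "(\<Sum>x\<in>X. ((\<Sum>y\<in>X. \<pi> t x y * g (t + 1) y) - g t x) * pmf (p t) x) = S (Suc t) - S t"
    if "t < N" for t
  proof -
    have "(\<Sum>x\<in>X. (\<Sum>y\<in>X. \<pi> t x y * g (t + 1) y) * pmf (p t) x)
        = (\<Sum>y\<in>X. \<Sum>x\<in>X. pmf (p t) x * \<pi> t x y * g (t + 1) y)"
      by (subst sum.swap) (simp add: sum_distrib_left sum_distrib_right mult_ac)
    also have "\<dots> = S (Suc t)"
      using assms that by (simp add: S_def bridge_feasible_def flip: sum_distrib_right)
    finally show ?thesis
      by (simp add: S_def algebra_simps sum_subtractf)
  qed
  then have "(\<Sum>t<N. \<Sum>x\<in>X. ((\<Sum>y\<in>X. \<pi> t x y * g (t + 1) y) - g t x) * pmf (p t) x)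
      = S N - S 0"
    by (simp add: sum_lessThan_telescope)
  then show ?thesis
    using assms by (simp add: S_def bridge_feasible_def)
qed

section \<open>Optimality of the transitions tilted by \<open>\<phi>\<close>\<close>

theorem theorem4:
  fixes n N :: nat
    and X :: "nat set"
    and G :: "nat pair_pre_digraph"
    and m :: "nat \<Rightarrow> nat \<Rightarrow> nat \<Rightarrow> real"
    and \<nu>0 \<nu>N :: "nat pmf"
    and \<phi> \<phi>h :: "nat \<Rightarrow> nat \<Rightarrow> real"
    and \<pi>s :: "nat \<Rightarrow> nat \<Rightarrow> nat \<Rightarrow> real"
  defines "X \<equiv> {1..n}"
    and "\<pi>s \<equiv> \<lambda>t i j. m t i j * (\<phi> (t + 1) j / \<phi> t i)"
  assumes "N \<ge> 1"
    and "pair_fin_digraph G" and "pverts G = X"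
    and "strongly_connected (with_proj G)" and "aperiodic (with_proj G)"
    and "\<And>t i j. t < N \<Longrightarrow> i \<in> X \<Longrightarrow> j \<in> X \<Longrightarrow> m t i j \<ge> 0"
    and "\<And>t i j. t < N \<Longrightarrow> i \<in> X \<Longrightarrow> j \<in> X \<Longrightarrow> (i, j) \<notin> parcs G \<Longrightarrow> m t i j = 0"
    and "set_pmf \<nu>0 \<subseteq> X" and "set_pmf \<nu>N \<subseteq> X"
    and "\<And>t i. t \<le> N \<Longrightarrow> i \<in> X \<Longrightarrow> \<phi> t i \<ge> 0"
    and "\<And>t i. t \<le> N \<Longrightarrow> i \<in> X \<Longrightarrow> \<phi>h t i \<ge> 0"
    and "\<And>t i. t < N \<Longrightarrow> i \<in> X \<Longrightarrow> \<phi> t i = (\<Sum>j\<in>X. m t i j * \<phi> (t + 1) j)"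
    and "\<And>t j. t < N \<Longrightarrow> j \<in> X \<Longrightarrow> \<phi>h (t + 1) j = (\<Sum>i\<in>X. m t i j * \<phi>h t i)"
    and "\<And>i. i \<in> X \<Longrightarrow> \<phi> 0 i * \<phi>h 0 i = pmf \<nu>0 i"
    and "\<And>i. i \<in> X \<Longrightarrow> \<phi> N i * \<phi>h N i = pmf \<nu>N i"
    and "\<And>t i. t \<le> N \<Longrightarrow> i \<in> X \<Longrightarrow> \<phi> t i > 0"
  shows "\<exists>P \<in> path_distributions G N \<nu>0 \<nu>N.
           markov_distribution X N \<nu>0 \<pi>s P \<and>
           solves_bridge_problem X N m \<nu>0 \<nu>N (path_marginal P) \<pi>s"
proof -
  have fin: "finite X" by (simp add: X_def)
  note m = assms(8) and marc = assms(9) and \<phi>_rec = assms(14) and \<phi>h_rec = assms(15)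
    and bd0 = assms(16) and bdN = assms(17) and \<phi> = assms(18)
  have \<pi>s_nonneg: "0 \<le> \<pi>s t x y" if "t < N" "x \<in> X" "y \<in> X" for t x y
    using m[OF that] \<phi>[of t x] \<phi>[of "t + 1" y] that by (simp add: \<pi>s_def)
  \<comment> \<open>This is the backward recursion for \<open>\<phi>\<close> divided by
    \<open>\<phi> t x\<close>.\<close>
  have \<pi>s_row: "(\<Sum>y\<in>X. \<pi>s t x y) = 1" if "t < N" "x \<in> X" for t x
    using \<phi>_rec[OF that] \<phi>[of t x] that by (simp add: \<pi>s_def flip: sum_divide_distrib)
  obtain P where P: "markov_distribution X N \<nu>0 \<pi>s P" and P0: "path_marginal P 0 = \<nu>0"
    and step: "\<And>t y. t < N \<Longrightarrow> y \<in> X \<Longrightarrow> pmf (path_marginal P (t + 1)) y =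
       (\<Sum>x\<in>X. pmf (path_marginal P t) x * \<pi>s t x y)"
    using markov_distribution_exists[of X \<nu>0 N \<pi>s] fin assms(10) \<pi>s_nonneg \<pi>s_row by blast
  \<comment> \<open>In the induction step \<open>\<phi> t i\<close> cancels the denominator of
    \<open>\<pi>s t i x\<close>, and what is left is \<open>\<phi> (Suc t) x\<close> times the
    forward recursion for \<open>\<phi>h\<close>. At time \<open>N\<close> the boundary condition
    then identifies the marginal as \<open>\<nu>N\<close>.\<close>
  have marg: "pmf (path_marginal P t) x = \<phi> t x * \<phi>h t x" if "t \<le> N" "x \<in> X" for t x
    using that
  proof (induction t arbitrary: x)
    case 0
    then show ?case using P0 bd0 by simp
  next
    case (Suc t)
    have "pmf (path_marginal P (Suc t)) x = (\<Sum>i\<in>X. \<phi> t i * \<phi>h t i * \<pi>s t i x)"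
      using step[of t x] Suc by simp
    also have "\<dots> = (\<Sum>i\<in>X. \<phi> (Suc t) x * (m t i x * \<phi>h t i))"
    proof (rule sum.cong[OF refl])
      fix i assume "i \<in> X"
      then have "0 < \<phi> t i" using \<phi> Suc.prems by simp
      then show "\<phi> t i * \<phi>h t i * \<pi>s t i x = \<phi> (Suc t) x * (m t i x * \<phi>h t i)"
        by (simp add: \<pi>s_def)
    qed
    also have "\<dots> = \<phi> (Suc t) x * \<phi>h (Suc t) x"
      using \<phi>h_rec[of t x] Suc.prems by (simp add: sum_distrib_left)
    finally show ?case .
  qed
  have margX: "set_pmf (path_marginal P t) \<subseteq> X" if "t \<le> N" for t
  proof
    fix y assume "y \<in> set_pmf (path_marginal P t)"
    then obtain x where "x \<in> set_pmf P" "y = x ! t" by (auto simp: path_marginal_def)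
    then show "y \<in> X" using P that by (force simp: markov_distribution_def)
  qed
  have PN: "path_marginal P N = \<nu>N"
    by (rule pmf_eqI_on[of _ X]) (use margX marg bdN assms(11) in auto)
  have "set_pmf P \<subseteq> feasible_paths G N"
    by (rule markov_distribution_feasible_paths[OF P assms(5)]) (simp add: \<pi>s_def marc)
  then have path: "P \<in> path_distributions G N \<nu>0 \<nu>N"
    using P0 PN by (simp add: path_distributions_def)
  have feas: "bridge_feasible X N \<nu>0 \<nu>N (path_marginal P) \<pi>s"
    using margX \<pi>s_nonneg \<pi>s_row step P0 PN by (simp add: bridge_feasible_def)
  define V where "V = ereal ((\<Sum>x\<in>X. pmf \<nu>N x * ln (\<phi> N x)) - (\<Sum>x\<in>X. pmf \<nu>0 x * ln (\<phi> 0 x)))"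
  \<comment> \<open>The telescoping identity is used backwards, expanding \<open>V\<close> along the
    given flow with potential \<open>ln (\<phi> t x)\<close>. The row bound then applies with
    \<open>h = \<phi> (t + 1)\<close> and \<open>c = \<phi> t x\<close>, and survives multiplication
    by the nonnegative mass \<open>pmf (p t) x\<close>.\<close>
  have lower: "V \<le> bridge_cost X N m p \<pi>" if f: "bridge_feasible X N \<nu>0 \<nu>N p \<pi>" for p \<pi>
    unfolding V_def bridge_potential_telescope[OF f, of "\<lambda>t x. ln (\<phi> t x)", symmetric] bridge_cost_def
    by (intro sum_mono ereal_mult_right_mono gibbs_variational_ge)
       (use f m \<phi> \<phi>_rec[symmetric] fin in \<open>auto simp: bridge_feasible_def\<close>)
  \<comment> \<open>The same expansion along the marginals of \<open>P\<close>, now with equality in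
    every row.\<close>
  have "bridge_cost X N m (path_marginal P) \<pi>s = V"
    unfolding V_def bridge_potential_telescope[OF feas, of "\<lambda>t x. ln (\<phi> t x)", symmetric]
      bridge_cost_def \<pi>s_def
    by (intro sum.cong refl arg_cong2[where f = "(*)"] gibbs_variational_eq)
       (use \<phi> \<phi>_rec[symmetric] in auto)
  then have "solves_bridge_problem X N m \<nu>0 \<nu>N (path_marginal P) \<pi>s"
    using feas lower by (auto simp: solves_bridge_problem_def is_arg_min_linorder)
  then show ?thesis using path P by blast
qed

end
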